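(* Let $\varepsilon>0$, $\delta>0$ and $c>1$ be such that $\varepsilon^2\geq 4\delta c\,\alpha(c)$, and let $u:\mathbb{R}\to\mathbb{R}$ be the (unique up to translations) traveling-wave solution of $$-cu - \frac{u}{u-c} + \frac{1}{2}u^2 + \delta c\,u'' - \varepsilon u' = 0 .$$ Then for all $\xi\in\mathbb{R}$, $0<u(\xi)<u_0$ and $u'(\xi)<0$. Moreover, $u$ has a unique inflection point $\xi_1$, and it satisfies $(\xi-\xi_1)u''(\xi)>0$ for all $\xi\neq\xi_1$.
   Context: Here $'=d/d\xi$, $$u_0=\frac{3c-\sqrt{c^2+8}}{2},\qquad \alpha(c)=\frac{c-\sqrt{c^2+8}}{2}+\frac{4c}{(c-\sqrt{c^2+8})^2}=u_0-c+\frac{c}{(u_0-c)^2}.$$ A traveling-wave solution is a smooth solution $u$ of the ODE on all of $\mathbb{R}$ (with $u(\xi)\neq c$ for all $\xi$) such that, with $\eta=\dfrac{u}{c-u}$, one has $\lim_{\xi\to-\infty}(\eta(\xi),u(\xi))=(\eta^-,u^-)$ for some finite $\eta^->0$, $u^->0$, $\lim_{\xi\to+\infty}(\eta(\xi),u(\xi))=(0,0)$, and $\lim_{\xi\to\pm\infty}(\eta^{(j)}(\xi),u^{(j)}(\xi))=(0,0)$ for $j=1,2,\dots$. Such a solution exists and is unique up to translations in $\xi$. *)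

theory Defs
  imports "HOL-Analysis.Analysis"
begin

definition u0 :: "real \<Rightarrow> real" where
  "u0 c = (3 * c - sqrt (c\<^sup>2 + 8)) / 2"

definition alpha :: "real \<Rightarrow> real" where
  "alpha c = (c - sqrt (c\<^sup>2 + 8)) / 2 + 4 * c / (c - sqrt (c\<^sup>2 + 8))\<^sup>2"

lemma alpha_eq_u0: "alpha c = u0 c - c + c / (u0 c - c)\<^sup>2"
proof -
  have eq: "u0 c - c = (c - sqrt (c\<^sup>2 + 8)) / 2"
    by (simp add: u0_def field_simps)
  show ?thesis
    unfolding eq alpha_def power_divide by simp
qed

text \<open>\<^term>\<open>deriv\<close> is a total function, so differentiability has to be required at every order.\<close>

definition smooth :: "(real \<Rightarrow> real) \<Rightarrow> bool" where
  "smooth f \<longleftrightarrow> (\<forall>n x. (deriv ^^ n) f field_differentiable (at x))"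

definition eta :: "real \<Rightarrow> (real \<Rightarrow> real) \<Rightarrow> real \<Rightarrow> real" where
  "eta c u \<xi> = u \<xi> / (c - u \<xi>)"

definition traveling_wave :: "real \<Rightarrow> real \<Rightarrow> real \<Rightarrow> (real \<Rightarrow> real) \<Rightarrow> bool" where
  "traveling_wave \<epsilon> \<delta> c u \<longleftrightarrow>
     smooth u \<and>
     (\<forall>\<xi>. u \<xi> \<noteq> c) \<and>
     (\<forall>\<xi>. - c * u \<xi> - u \<xi> / (u \<xi> - c) + 1 / 2 * (u \<xi>)\<^sup>2
            + \<delta> * c * deriv (deriv u) \<xi> - \<epsilon> * deriv u \<xi> = 0) \<and>
     (\<exists>\<eta>m>0. \<exists>um>0. ((\<lambda>\<xi>. (eta c u \<xi>, u \<xi>)) \<longlongrightarrow> (\<eta>m, um)) at_bot) \<and>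
     ((\<lambda>\<xi>. (eta c u \<xi>, u \<xi>)) \<longlongrightarrow> (0, 0)) at_top \<and>
     (\<forall>j\<ge>1. ((\<lambda>\<xi>. ((deriv ^^ j) (eta c u) \<xi>, (deriv ^^ j) u \<xi>)) \<longlongrightarrow> (0, 0)) at_bot \<and>
             ((\<lambda>\<xi>. ((deriv ^^ j) (eta c u) \<xi>, (deriv ^^ j) u \<xi>)) \<longlongrightarrow> (0, 0)) at_top)"

text \<open>For a smooth function, an inflection point is a point at which the second derivative changes
  sign, in either direction. A mere zero of the second derivative does not count.\<close>

definition inflection_point :: "(real \<Rightarrow> real) \<Rightarrow> real \<Rightarrow> bool" where
  "inflection_point f x \<longleftrightarrow>
     (\<exists>d>0. (\<forall>y\<in>{x-d<..<x}. deriv (deriv f) y < 0) \<and> (\<forall>y\<in>{x<..<x+d}. deriv (deriv f) y > 0) \<or>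
            (\<forall>y\<in>{x-d<..<x}. deriv (deriv f) y > 0) \<and> (\<forall>y\<in>{x<..<x+d}. deriv (deriv f) y < 0))"

end

theory Submission
  imports Defs "HOL-Real_Asymp.Real_Asymp"
begin

text \<open>
  Put \<open>k = \<delta> c\<close> and write the equation as \<open>k u'' = \<epsilon> u' + F u\<close>, where \<open>F\<close> is strictly concave on
  \<open>(-\<infinity>, c)\<close>, vanishes at \<open>0\<close> and at \<open>u\<^sub>0\<close>, and has slope \<open>-\<alpha>\<close> at \<open>u\<^sub>0\<close>; the wave stays below \<open>c\<close>
  and starts from \<open>u\<^sub>0\<close>.

  The discriminant condition gives a real root \<open>\<lambda> > 0\<close> of \<open>k \<lambda>\<^sup>2 - \<epsilon> \<lambda> + \<alpha> = 0\<close>. By concavity,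
  \<open>W = - u' - \<lambda> (u\<^sub>0 - u)\<close> times a suitable exponential is nondecreasing, and \<open>W\<close> is negative
  near \<open>+\<infinity>\<close>, so \<open>W < 0\<close> everywhere. Then \<open>(u\<^sub>0 - u) exp (- \<lambda> \<xi>)\<close> is decreasing and
  positive near \<open>+\<infinity>\<close>, so \<open>u < u\<^sub>0\<close>. A negative minimum is impossible since \<open>F < 0\<close> on the negative axis,
  and a zero of \<open>u\<close> would be a double zero, forcing \<open>u = 0\<close> to its left by Gronwall; hence \<open>u > 0\<close>.

  Now \<open>F u > 0\<close>, so \<open>u' exp (- \<epsilon> \<xi> / k)\<close> increases, and a nonnegative value of \<open>u'\<close> would keep \<open>u\<close>
  away from \<open>0\<close>. Finally \<open>u'' exp (- \<epsilon> \<xi> / k)\<close> has derivative of the sign of \<open>F' u * u'\<close>: as \<open>u\<close>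
  decreases from \<open>u\<^sub>0\<close> to \<open>0\<close> this function first increases, then decreases to \<open>0\<close>, so it changes
  sign at most once. It does so because \<open>u'\<close> vanishes at \<open>-\<infinity>\<close> and is negative.
\<close>

section \<open>The nonlinearity\<close>

definition F :: "real \<Rightarrow> real \<Rightarrow> real" where
  "F c x = c * x + x / (x - c) - x\<^sup>2 / 2"

definition dF :: "real \<Rightarrow> real \<Rightarrow> real" where
  "dF c x = c - x - c / (c - x)\<^sup>2"

lemma F_DERIV:
  assumes "x < c"
  shows "(F c has_real_derivative dF c x) (at x)"
proof -
  have "(F c has_real_derivative c + (1 * (x - c) - x * 1) / ((x - c) * (x - c)) - 2 * x / 2) (at x)"
    unfolding F_def [abs_def] using assms by (auto intro!: derivative_eq_intros)
  moreover have "c + (1 * (x - c) - x * 1) / ((x - c) * (x - c)) - 2 * x / 2 = dF c x"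
    unfolding dF_def power2_commute[of c x] by (simp add: power2_eq_square)
  ultimately show ?thesis by simp
qed

text \<open>The quadratic terms of \<open>F\<close> leave the remainder
  \<open>(x - a)\<^sup>2 / 2\<close> and the pole leaves the other summand. The exact form yields
  both concavity and the strict inequality behind \<open>alpha_pos\<close>.\<close>

lemma F_tangent:
  assumes "x < c" "a < c"
  shows "F c x = F c a + dF c a * (x - a) - (x - a)\<^sup>2 * (1 / 2 + c / ((c - x) * (c - a)\<^sup>2))"
proof -
  define p q where "p = c - x" and "q = c - a"
  have pq: "p > 0" "q > 0" using assms by (auto simp: p_def q_def)
  have "x / (x - c) = 1 - c / p" "a / (a - c) = 1 - c / q"
    using assms by (simp_all add: p_def q_def divide_simps algebra_simps)
  moreover have "c * (1 / p - 1 / q - (x - a) / q\<^sup>2) = c / p - c / q - c / q\<^sup>2 * (x - a)"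
    by (simp add: algebra_simps)
  moreover have "c * x - x\<^sup>2 / 2 - (c * a - a\<^sup>2 / 2) - (c - a) * (x - a) = - (x - a)\<^sup>2 / 2"
    by (simp add: field_simps power2_eq_square)
  moreover have "dF c a * (x - a) = (c - a) * (x - a) - c / q\<^sup>2 * (x - a)"
    by (simp add: dF_def q_def left_diff_distrib)
  ultimately have "F c x - F c a - dF c a * (x - a) =
      - (x - a)\<^sup>2 / 2 - c * (1 / p - 1 / q - (x - a) / q\<^sup>2)"
    unfolding F_def by linarith
  also have "1 / p - 1 / q - (q - p) / q\<^sup>2 = (q - p)\<^sup>2 / (p * q\<^sup>2)"
    using pq by (simp add: divide_simps) (simp add: algebra_simps power2_eq_square)
  then have "1 / p - 1 / q - (x - a) / q\<^sup>2 = (x - a)\<^sup>2 / (p * q\<^sup>2)"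
    by (simp add: p_def q_def)
  finally show ?thesis by (simp add: p_def q_def algebra_simps)
qed

lemma F_le_tangent:
  assumes "x < c" "a < c" "c > 0"
  shows "F c x \<le> F c a + dF c a * (x - a)"
proof -
  have "0 \<le> (x - a)\<^sup>2 * (1 / 2 + c / ((c - x) * (c - a)\<^sup>2))"
    using assms by (intro mult_nonneg_nonneg add_nonneg_nonneg divide_nonneg_nonneg) auto
  then show ?thesis using F_tangent[OF assms(1,2)] by linarith
qed

lemma u0_bounds:
  assumes "c > 1"
  shows "0 < u0 c" "u0 c < c"
proof -
  have "1 < c * c" using assms by (simp add: less_1_mult)
  then have "sqrt (c\<^sup>2 + 8) < sqrt ((3 * c)\<^sup>2)"
    by (intro real_sqrt_less_mono) (simp add: power2_eq_square)
  then show "0 < u0 c" using assms unfolding u0_def real_sqrt_abs by simp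
  have "sqrt (c\<^sup>2) < sqrt (c\<^sup>2 + 8)" by (intro real_sqrt_less_mono) simp
  then show "u0 c < c" using assms unfolding u0_def real_sqrt_abs by simp
qed

text \<open>Over the common denominator a quadratic with roots \<open>u0 c\<close> and
  \<open>3 * c - u0 c\<close> splits off. For c > 1 the second root exceeds c, so below c only 0 and
  \<open>u0 c\<close> decide the sign of \<open>F\<close>.\<close>

lemma F_factor:
  assumes "x < c"
  shows "F c x = x * (u0 c - x) * ((3 * c - u0 c) - x) / (2 * (c - x))"
proof -
  have "(sqrt (c\<^sup>2 + 8))\<^sup>2 = c\<^sup>2 + 8" by (intro real_sqrt_pow2) simp
  then have "(u0 c - x) * ((3 * c - u0 c) - x) = 2 * c\<^sup>2 - 2 - 3 * c * x + x\<^sup>2"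
    unfolding u0_def by (simp add: field_simps power2_eq_square)
  then have "x * (u0 c - x) * ((3 * c - u0 c) - x) = x * (2 * c\<^sup>2 - 2 - 3 * c * x + x\<^sup>2)"
    by (simp only: mult.assoc)
  moreover have "F c x = x * (2 * c\<^sup>2 - 2 - 3 * c * x + x\<^sup>2) / (2 * (c - x))"
    using assms unfolding F_def by (simp add: divide_simps) (simp add: algebra_simps power2_eq_square)
  ultimately show ?thesis by (simp only:)
qed

lemma F_zero [simp]: "F c 0 = 0"
  by (simp add: F_def)

lemma F_u0: "c > 1 \<Longrightarrow> F c (u0 c) = 0"
  by (simp add: F_factor u0_bounds)

lemma F_pos:
  assumes "c > 1" "0 < x" "x < u0 c"
  shows "F c x > 0"
  using assms u0_bounds[OF assms(1)] by (subst F_factor) auto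

lemma F_neg:
  assumes "c > 1" "x < 0"
  shows "F c x < 0"
proof -
  have "x * (u0 c - x) * ((3 * c - u0 c) - x) < 0"
    using assms u0_bounds[OF assms(1)] by (intro mult_neg_pos) auto
  then show ?thesis using assms by (subst F_factor) (auto intro!: divide_neg_pos)
qed

lemma alpha_eq_dF: "alpha c = - dF c (u0 c)"
  by (simp add: alpha_eq_u0 dF_def power2_commute)

lemma dF_strict_antimono:
  assumes "x < y" "y < c" "c > 0"
  shows "dF c y < dF c x"
proof -
  have "(c - y)\<^sup>2 < (c - x)\<^sup>2" using assms by (intro power_strict_mono) auto
  then have "c / (c - x)\<^sup>2 < c / (c - y)\<^sup>2"
    using assms by (intro divide_strict_left_mono) auto
  then show ?thesis using assms by (simp add: dF_def)
qed

lemma dF_zero_pos: "c > 1 \<Longrightarrow> dF c 0 > 0"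
  by (simp add: dF_def power2_eq_square field_simps less_1_mult)

lemma dF_zero_le: "c > 1 \<Longrightarrow> dF c 0 \<le> c"
  by (simp add: dF_def)

lemma alpha_pos:
  assumes "c > 1"
  shows "alpha c > 0"
proof -
  note b = u0_bounds[OF assms]
  \<comment> \<open>Expand at \<open>u0 c\<close> and evaluate at 0: both values of \<open>F\<close>
    vanish, so the slope term has to balance this strictly positive remainder.\<close>
  have "0 < (u0 c)\<^sup>2 * (1 / 2 + c / ((c - 0) * (c - u0 c)\<^sup>2))"
    using b assms by (intro mult_pos_pos add_pos_nonneg) auto
  then have "dF c (u0 c) * u0 c < 0"
    using F_tangent[of 0 c "u0 c"] b assms F_u0[OF assms] by simp
  then show ?thesis using b by (simp add: alpha_eq_dF mult_less_0_iff)
qed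

lemma dF_root:
  assumes "c > 1"
  obtains s where "0 < s" "s < u0 c" "dF c s = 0"
proof -
  note b = u0_bounds[OF assms]
  have neg: "dF c (u0 c) < 0" using alpha_pos[OF assms] by (simp add: alpha_eq_dF)
  have "continuous_on {0..u0 c} (dF c)"
    unfolding dF_def [abs_def] using b by (intro continuous_intros) auto
  then obtain s where "0 \<le> s" "s \<le> u0 c" "dF c s = 0"
    using IVT2'[of "dF c" "u0 c" 0 0] neg dF_zero_pos[OF assms] b by auto
  moreover have "s \<noteq> 0" "s \<noteq> u0 c" using calculation neg dF_zero_pos[OF assms] by auto
  ultimately show ?thesis using that[of s] by simp
qed

section \<open>Integrating factors\<close>

lemma DERIV_exp_weight:
  fixes f :: "real \<Rightarrow> real"
  assumes "(f has_real_derivative f') (at x)"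
  shows "((\<lambda>x. f x * exp (- (m * x))) has_real_derivative (f' - m * f x) * exp (- (m * x))) (at x)"
  using assms by (auto intro!: derivative_eq_intros simp: algebra_simps)

lemma exp_weight_mono:
  fixes f f' :: "real \<Rightarrow> real"
  assumes "\<And>x. (f has_real_derivative f' x) (at x)" "\<And>x. f' x \<ge> m * f x" "a \<le> b"
  shows "f a * exp (- (m * a)) \<le> f b * exp (- (m * b))"
  by (rule DERIV_nonneg_imp_nondecreasing[OF assms(3)])
     (intro exI conjI, rule DERIV_exp_weight[OF assms(1)], simp add: assms(2))

lemma exp_weight_strict_mono:
  fixes f f' :: "real \<Rightarrow> real"
  assumes d: "\<And>x. (f has_real_derivative f' x) (at x)"
    and "\<And>x. a < x \<Longrightarrow> x < b \<Longrightarrow> f' x > m * f x" and "a < b"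
  shows "f a * exp (- (m * a)) < f b * exp (- (m * b))"
proof (rule DERIV_pos_imp_increasing_open[OF assms(3)])
  show "\<exists>y. ((\<lambda>x. f x * exp (- (m * x))) has_real_derivative y) (at x) \<and> 0 < y"
    if "a < x" "x < b" for x
    by (intro exI conjI, rule DERIV_exp_weight[OF d]) (simp add: assms(2) that)
  show "continuous_on {a..b} (\<lambda>x. f x * exp (- (m * x)))"
    by (rule DERIV_continuous_on, rule has_field_derivative_at_within, rule DERIV_exp_weight, rule d)
qed

text \<open>The weighted function is nondecreasing, so negativity far to the right propagates to the
  left.\<close>

lemma neg_of_exp_weight_mono:
  fixes f f' :: "real \<Rightarrow> real"
  assumes "\<And>x. (f has_real_derivative f' x) (at x)" "\<And>x. f' x \<ge> m * f x"
    and "eventually (\<lambda>x. f x < 0) at_top"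
  shows "f x < 0"
proof -
  obtain b where b: "b \<ge> x" "f b < 0"
    using eventually_conj[OF eventually_ge_at_top[of x] assms(3)]
    by (auto dest: eventually_happens simp: trivial_limit_at_top_linorder)
  have "f x * exp (- (m * x)) \<le> f b * exp (- (m * b))"
    by (rule exp_weight_mono[OF assms(1,2) b(1)])
  also have "\<dots> < 0" using b by (simp add: mult_neg_pos)
  finally show ?thesis by (simp add: mult_less_0_iff)
qed

section \<open>Waves\<close>

text \<open>Here \<open>v\<close>, \<open>w\<close> stand for u', u'' and \<open>k\<close> for
  \<delta> c. The bound \<open>less_c\<close> and the value of the left limit are derived from
  \<open>traveling_wave\<close> in \<open>traveling_wave_wave\<close>.\<close>

locale wave =
  fixes k e c :: real and u v w :: "real \<Rightarrow> real"
  assumes k: "k > 0" and e: "e > 0" and c: "c > 1"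
    and disc: "e\<^sup>2 \<ge> 4 * k * alpha c"
    and less_c: "u x < c"
    and Du: "(u has_real_derivative v x) (at x)"
    and Dv: "(v has_real_derivative w x) (at x)"
    and ode: "k * w x = e * v x + F c (u x)"
    and u_bot: "(u \<longlongrightarrow> u0 c) at_bot" and u_top: "(u \<longlongrightarrow> 0) at_top"
    and v_bot: "(v \<longlongrightarrow> 0) at_bot" and v_top: "(v \<longlongrightarrow> 0) at_top"
    and w_top: "(w \<longlongrightarrow> 0) at_top"
begin

lemma w_eq: "w x = (e * v x + F c (u x)) / k"
  using ode[of x] k by (simp add: field_simps)

lemma Dw: "(w has_real_derivative (e * w x + dF c (u x) * v x) / k) (at x)"
proof -
  have "((\<lambda>x. F c (u x)) has_real_derivative dF c (u x) * v x) (at x)"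
    by (rule DERIV_chain2[OF F_DERIV[OF less_c] Du])
  then show ?thesis
    unfolding w_eq [abs_def] using k
    by (auto intro!: derivative_eq_intros Dv[unfolded w_eq] simp: w_eq)
qed

lemma cont_u: "continuous_on S u"
  using Du by (intro DERIV_continuous_on) (rule has_field_derivative_at_within)

lemma cont_w: "continuous_on S w"
  using Dw by (intro DERIV_continuous_on) (rule has_field_derivative_at_within)

section \<open>Bounds on the wave\<close>

lemma less_u0: "u x < u0 c"
proof -
  note b = u0_bounds[OF c]
  \<comment> \<open>The larger of the two characteristic roots, visibly positive.\<close>
  define l where "l = (e + sqrt (e\<^sup>2 - 4 * k * alpha c)) / (2 * k)"
  have sq: "(sqrt (e\<^sup>2 - 4 * k * alpha c))\<^sup>2 = e\<^sup>2 - 4 * k * alpha c"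
    using disc by (intro real_sqrt_pow2) simp
  have "sqrt (e\<^sup>2 - 4 * k * alpha c) \<ge> 0" using disc by simp
  then have lpos: "l > 0" using e k by (simp add: l_def add_pos_nonneg)
  have "2 * k * l - e = sqrt (e\<^sup>2 - 4 * k * alpha c)" using k by (simp add: l_def)
  then have "(2 * k * l - e)\<^sup>2 = e\<^sup>2 - 4 * k * alpha c" by (simp only: sq)
  then have "4 * k * (k * l * l - e * l + alpha c) = 0" by (simp add: power2_eq_square algebra_simps)
  then have root: "alpha c = e * l - k * l * l" using k by simp
  define W where "W = (\<lambda>x. - v x - l * (u0 c - u x))"
  have DW: "(W has_real_derivative (- w x + l * v x)) (at x)" for x
    unfolding W_def by (auto intro!: derivative_eq_intros Du Dv)
  \<comment> \<open>By \<open>root\<close>, k W' - (e - k l) W equals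
    \<open>alpha c * (u0 c - u x) - F c (u x)\<close>, the gap between the tangent at
    \<open>u0 c\<close> and \<open>F\<close>.\<close>
  have "- w x + l * v x \<ge> (e - k * l) / k * W x" for x
  proof -
    have "F c (u x) \<le> alpha c * (u0 c - u x)"
      using F_le_tangent[of "u x" c "u0 c"] less_c[of x] b c F_u0[OF c]
      by (simp add: alpha_eq_dF algebra_simps)
    then have "(e - k * l) * W x \<le> k * (- w x + l * v x)"
      using ode[of x] unfolding root W_def by (simp add: algebra_simps)
    then show ?thesis using k by (simp add: pos_divide_le_eq mult.commute)
  qed
  moreover have "(W \<longlongrightarrow> - 0 - l * (u0 c - 0)) at_top"
    unfolding W_def by (intro tendsto_intros u_top v_top)
  then have "eventually (\<lambda>x. W x < 0) at_top"
    by (rule order_tendstoD) (use lpos b in simp)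
  ultimately have Wneg: "W x < 0" for x
    using neg_of_exp_weight_mono[OF DW] by blast
  have "((\<lambda>x. u x - u0 c) has_real_derivative v x) (at x)" for x
    by (auto intro!: derivative_eq_intros Du)
  moreover have "v x \<ge> l * (u x - u0 c)" for x
    using Wneg[of x] by (simp add: W_def algebra_simps)
  moreover have "eventually (\<lambda>x. u x - u0 c < 0) at_top"
    using order_tendstoD(2)[OF u_top b(1)] by simp
  ultimately have "u x - u0 c < 0"
    by (rule neg_of_exp_weight_mono)
  then show ?thesis by simp
qed

lemma nonneg: "u x \<ge> 0"
proof (rule ccontr)
  assume "\<not> u x \<ge> 0"
  then have neg: "u x < 0" by simp
  \<comment> \<open>Both limits exceed \<open>u x\<close>, so a minimum over a large compact
    interval is global.\<close>
  have "eventually (\<lambda>y. u y > u x) at_bot"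
    by (rule order_tendstoD(1)[OF u_bot]) (use neg u0_bounds[OF c] in simp)
  then obtain A where A: "\<And>y. y \<le> A \<Longrightarrow> u y > u x" by (auto simp: eventually_at_bot_linorder)
  have "eventually (\<lambda>y. u y > u x) at_top"
    by (rule order_tendstoD(1)[OF u_top neg])
  then obtain B where B: "\<And>y. y \<ge> B \<Longrightarrow> u y > u x" by (auto simp: eventually_at_top_linorder)
  have AB: "A < x" "x < B" using A[of x] B[of x] by force+
  obtain m where m: "m \<in> {A..B}" "\<And>y. y \<in> {A..B} \<Longrightarrow> u m \<le> u y"
    using continuous_attains_inf[of "{A..B}" u] cont_u AB by auto
  have umx: "u m \<le> u x" using m(2) AB by simp
  have min: "u m \<le> u y" for y
    using m(2)[of y] A[of y] B[of y] umx by (cases "y \<le> A"; cases "y \<ge> B") auto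
  have vm: "v m = 0" by (rule DERIV_local_min[OF Du zero_less_one]) (simp add: min)
  have "k * w m < 0" using ode[of m] vm F_neg[OF c, of "u m"] umx neg by simp
  then have "w m < 0" using k by (simp add: mult_less_0_iff)
  \<comment> \<open>As \<open>v m = 0\<close> and \<open>w m < 0\<close>, u' is negative just to the
    right of \<open>m\<close>, and \<open>u\<close> drops below its minimum.\<close>
  from DERIV_neg_dec_right[OF Dv this] obtain d
    where d: "d > 0" "\<And>h. 0 < h \<Longrightarrow> h < d \<Longrightarrow> v (m + h) < v m" by blast
  have "u (m + d / 2) < u m"
  proof (rule DERIV_neg_imp_decreasing_open[where f = u and a = m and b = "m + d / 2"])
    show "\<exists>y. (u has_real_derivative y) (at z) \<and> y < 0" if "m < z" "z < m + d / 2" for z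
      using d(2)[of "z - m"] that vm d(1) by (intro exI[of _ "v z"]) (auto simp: Du)
  qed (use d cont_u in auto)
  then show False using min[of "m + d / 2"] by simp
qed

lemma pos: "u x > 0"
proof (rule ccontr)
  assume "\<not> u x > 0"
  then have ux: "u x = 0" using nonneg[of x] by simp
  have vx: "v x = 0" by (rule DERIV_local_min[OF Du zero_less_one]) (simp add: nonneg ux)
  define Q where "Q = (\<lambda>x. (u x)\<^sup>2 + (v x)\<^sup>2)"
  have DQ: "(Q has_real_derivative 2 * u x * v x + 2 * v x * w x) (at x)" for x
    unfolding Q_def by (auto intro!: derivative_eq_intros Du Dv)
  have "2 * u y * v y + 2 * v y * w y \<ge> - (1 + c / k) * Q y" for y
  proof -
    have F1: "F c (u y) \<le> c * u y"
      using F_le_tangent[of "u y" c 0] less_c[of y] c mult_right_mono[OF dF_zero_le[OF c] nonneg[of y]]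
      by simp
    have F0: "0 \<le> F c (u y)"
      using F_pos[OF c, of "u y"] less_u0[of y] nonneg[of y] by (cases "u y = 0") auto
    have "2 * (\<bar>v y\<bar> * F c (u y)) \<le> 2 * (\<bar>v y\<bar> * (c * u y))"
      using F1 by (simp add: mult_left_mono)
    also have "\<dots> = c * (2 * \<bar>v y\<bar> * u y)" by simp
    also have "\<dots> \<le> c * Q y"
    proof (intro mult_left_mono)
      show "2 * \<bar>v y\<bar> * u y \<le> Q y"
        unfolding Q_def using sum_squares_bound[of "\<bar>v y\<bar>" "u y"] by simp
    qed (use c in simp)
    finally have "- (c * Q y) \<le> 2 * (v y * F c (u y))"
      using mult_right_mono[OF abs_ge_minus_self[of "v y"] F0] by simp
    moreover have "0 \<le> 2 * (e * (v y)\<^sup>2)" using e by simp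
    moreover have "- (k * Q y) \<le> k * (2 * u y * v y)"
    proof -
      have "0 \<le> (u y + v y)\<^sup>2" by simp
      then have "- Q y \<le> 2 * u y * v y" unfolding Q_def power2_sum by linarith
      from mult_left_mono[OF this, of k] k show ?thesis by simp
    qed
    moreover have "k * (2 * v y * w y) = 2 * (e * (v y)\<^sup>2) + 2 * (v y * F c (u y))"
    proof -
      have "k * (2 * v y * w y) = 2 * v y * (k * w y)" by simp
      then show ?thesis unfolding ode by (simp add: algebra_simps power2_eq_square)
    qed
    ultimately have "- (k * Q y) - c * Q y \<le> k * (2 * u y * v y + 2 * v y * w y)"
      unfolding distrib_left by linarith
    moreover have "k * (- (1 + c / k) * Q y) = - (k * Q y) - c * Q y"
      using k by (simp add: field_simps)
    ultimately show ?thesis using k by (metis mult_le_cancel_left_pos)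
  qed
  note mono = exp_weight_mono[OF DQ this]
  have "u y = 0" if "y \<le> x" for y
  proof -
    have "Q y * exp (- (- (1 + c / k) * y)) \<le> 0"
      using mono[OF that] by (simp add: Q_def ux vx)
    then have "Q y \<le> 0" by (simp add: mult_le_0_iff)
    then show ?thesis by (simp add: Q_def sum_power2_le_zero_iff)
  qed
  then have "eventually (\<lambda>y. u y = 0) at_bot"
    by (auto simp: eventually_at_bot_linorder)
  then have "(u \<longlongrightarrow> 0) at_bot" by (rule tendsto_eventually)
  then show False using tendsto_unique[OF _ u_bot] u0_bounds[OF c] by force
qed

section \<open>Monotonicity and convexity\<close>

lemma decreasing: "v x < 0"
proof (rule ccontr)
  assume "\<not> v x < 0"
  have "v x * exp (- (e / k * x)) < v y * exp (- (e / k * y))" if "x < y" for y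
  proof (rule exp_weight_strict_mono[OF Dv _ that])
    show "e / k * v z < w z" for z
      using F_pos[OF c pos less_u0, of z] k by (simp add: w_eq add_divide_distrib)
  qed
  moreover have "0 \<le> v x * exp (- (e / k * x))" using \<open>\<not> v x < 0\<close> by simp
  ultimately have vpos: "v y > 0" if "x < y" for y
    using that by (fastforce simp: zero_less_mult_iff dest: le_less_trans)
  have "u x \<le> u y" if "x \<le> y" for y
    by (rule DERIV_nonneg_imp_nondecreasing[OF that])
       (metis Du \<open>\<not> v x < 0\<close> less_eq_real_def not_le vpos)
  then have "eventually (\<lambda>y. u x \<le> u y) at_top" by (auto simp: eventually_at_top_linorder)
  then have "u x \<le> 0" by (intro tendsto_lowerbound[OF u_top]) auto
  then show False using pos[of x] by simp
qed

lemma u_strict_antimono: "x < y \<Longrightarrow> u y < u x"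
  by (rule DERIV_neg_imp_decreasing) (use Du decreasing in blast)+

lemma inflection:
  obtains r where "w r = 0" "\<And>x. x < r \<Longrightarrow> w x < 0" "\<And>x. r < x \<Longrightarrow> w x > 0"
proof -
  obtain s where s: "0 < s" "s < u0 c" "dF c s = 0" by (rule dF_root[OF c])
  obtain a where a: "u a > s"
    using eventually_happens[OF order_tendstoD(1)[OF u_bot s(2)]] by auto
  obtain b where b: "u b < s"
    using eventually_happens[OF order_tendstoD(2)[OF u_top s(1)]]
    by (auto simp: trivial_limit_at_top_linorder)
  have "a < b" using a b u_strict_antimono[of b a] by (cases a b rule: linorder_cases) auto
  \<comment> \<open>At \<open>q\<close> the decreasing wave passes the maximum point
    \<open>s\<close> of \<open>F\<close>; there F'(u) turns from negative to positive.\<close>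
  then obtain q where q: "u q = s"
    using IVT2'[of u b s a] a b cont_u by auto
  have before: "dF c (u x) < 0" if "x < q" for x
    using dF_strict_antimono[of s "u x" c] u_strict_antimono[OF that] q s(3) less_c c by simp
  have after: "dF c (u x) > 0" if "q < x" for x
    using dF_strict_antimono[of "u x" s c] u_strict_antimono[OF that] q s(3) less_c[of q] c by simp
  \<comment> \<open>The weight cancels the term e w in the differentiated equation k w' = e w +
    F'(u) v.\<close>
  define y where "y = (\<lambda>x. w x * exp (- (e / k * x)))"
  have inc: "y x < y z" if "x < z" "z \<le> q" for x z
    unfolding y_def
  proof (rule exp_weight_strict_mono[OF Dw _ that(1)])
    fix t assume "x < t" "t < z"
    then have "dF c (u t) * v t > 0" using before[of t] decreasing[of t] that
      by (intro mult_neg_neg) auto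
    then show "e / k * w t < (e * w t + dF c (u t) * v t) / k"
      using k by (simp add: add_divide_distrib)
  qed
  have dec: "y x > y z" if "x < z" "q \<le> x" for x z
  proof -
    have "- w x * exp (- (e / k * x)) < - w z * exp (- (e / k * z))"
    proof (rule exp_weight_strict_mono[OF DERIV_minus[OF Dw] _ that(1)])
      fix t assume "x < t" "t < z"
      then have "dF c (u t) * v t < 0" using after[of t] decreasing[of t] that
        by (intro mult_pos_neg) auto
      then show "e / k * - w t < - ((e * w t + dF c (u t) * v t) / k)"
        using k by (simp add: add_divide_distrib divide_neg_pos)
    qed
    then show ?thesis by (simp add: y_def)
  qed
  have "((\<lambda>x. exp (- (e / k * x))) \<longlongrightarrow> 0) at_top"
    using e k by real_asymp
  from tendsto_mult[OF w_top this] have ytop: "(y \<longlongrightarrow> 0) at_top" by (simp add: y_def)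
  have y_pos: "y x > 0" if "q \<le> x" for x
  proof -
    \<comment> \<open>The limit gives only \<open>0 \<le> y (x + 1)\<close>; strict decrease from
      \<open>x\<close> to \<open>x + 1\<close> then makes \<open>y x\<close> positive.\<close>
    have "eventually (\<lambda>z. y z \<le> y (x + 1)) at_top"
      unfolding eventually_at_top_linorder
    proof (intro exI[of _ "x + 1"] allI impI)
      fix z assume "x + 1 \<le> z"
      then show "y z \<le> y (x + 1)" using dec[of "x + 1" z] that by (cases "z = x + 1") auto
    qed
    then have "0 \<le> y (x + 1)" by (intro tendsto_upperbound[OF ytop]) auto
    then show ?thesis using dec[of x "x + 1"] that by simp
  qed
  have y_sign: "(y x > 0 \<longleftrightarrow> w x > 0) \<and> (y x < 0 \<longleftrightarrow> w x < 0) \<and> (y x = 0 \<longleftrightarrow> w x = 0)" for x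
    by (simp add: y_def zero_less_mult_iff mult_less_0_iff)
  have "\<exists>p. w p \<le> 0"
  proof (rule ccontr)
    assume "\<not> ?thesis"
    then have wp: "w x > 0" for x by (simp add: not_le)
    have "v x \<le> v 0" if "x \<le> 0" for x
      by (rule DERIV_nonneg_imp_nondecreasing[OF that]) (use Dv wp less_imp_le in blast)
    then have "eventually (\<lambda>x. v x \<le> v 0) at_bot" by (auto simp: eventually_at_bot_linorder)
    then have "0 \<le> v 0" by (intro tendsto_upperbound[OF v_bot]) auto
    then show False using decreasing[of 0] by simp
  qed
  then obtain p where p: "w p \<le> 0" ..
  have "p < q" using y_pos[of p] y_sign[of p] p by (cases "q \<le> p") auto
  \<comment> \<open>A zero lies between \<open>p\<close> and \<open>q\<close>. It is the only one:
    \<open>y\<close> increases strictly up to \<open>q\<close> and is positive from there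
    on.\<close>
  then obtain r where r: "r \<le> q" "w r = 0"
    using IVT'[of w p 0 q] p y_pos[of q] y_sign[of q] cont_w by force
  have "w x < 0" if "x < r" for x
    using inc[OF that r(1)] y_sign[of x] y_sign[of r] r(2) by simp
  moreover have "w x > 0" if "r < x" for x
    using inc[OF that] y_sign[of x] y_sign[of r] r(2) y_pos[of x] by (cases "x \<le> q") auto
  ultimately show ?thesis using that r(2) by blast
qed

end

section \<open>From traveling waves to the locale\<close>

lemma less_of_tendsto_less:
  fixes f :: "real \<Rightarrow> real"
  assumes "continuous_on UNIV f" "\<And>x. f x \<noteq> c" "(f \<longlongrightarrow> l) at_top" "l < c"
  shows "f x < c"
proof (rule ccontr)
  assume "\<not> f x < c"
  then have "c \<le> f x" by simp
  obtain y where "y \<ge> x" "f y < c"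
    using eventually_conj[OF eventually_ge_at_top[of x] order_tendstoD(2)[OF assms(3,4)]]
    by (auto dest: eventually_happens simp: trivial_limit_at_top_linorder)
  then show False
    using IVT2'[of f y c x] \<open>c \<le> f x\<close> continuous_on_subset[OF assms(1)] assms(2) by auto
qed

text \<open>Passing to the limit in u = \<eta> (c - u) excludes the limit c, since it would force
  \<open>um = 0\<close>. Hence \<open>F\<close> is continuous at \<open>um\<close>, so
  \<open>um\<close> is a positive root of \<open>F\<close> below c.\<close>

lemma traveling_wave_limit:
  assumes c: "c > 1" and less_c: "\<And>x. u x < c"
    and eta: "(eta c u \<longlongrightarrow> \<eta>) F'" "F' \<noteq> bot" and um: "um > 0" "(u \<longlongrightarrow> um) F'"
    and F: "((\<lambda>x. F c (u x)) \<longlongrightarrow> 0) F'"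
  shows "um = u0 c"
proof -
  have "um \<le> c"
    by (rule tendsto_upperbound[OF um(2) _ eta(2)]) (simp add: less_imp_le less_c)
  have "((\<lambda>x. eta c u x * (c - u x)) \<longlongrightarrow> \<eta> * (c - um)) F'"
    by (intro tendsto_intros eta um)
  moreover have "eta c u x * (c - u x) = u x" for x
    using less_c[of x] by (simp add: eta_def)
  ultimately have "(u \<longlongrightarrow> \<eta> * (c - um)) F'" by (simp only:)
  from tendsto_unique[OF eta(2) um(2) this] have "um = \<eta> * (c - um)" .
  then have "um < c" using um(1) \<open>um \<le> c\<close> by (cases "um = c") auto
  have "((\<lambda>x. F c (u x)) \<longlongrightarrow> F c um) F'"
    by (rule isCont_tendsto_compose[OF DERIV_isCont[OF F_DERIV[OF \<open>um < c\<close>]] um(2)])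
  then have "F c um = 0" using tendsto_unique[OF eta(2) _ F] by blast
  then show ?thesis
    using F_factor[OF \<open>um < c\<close>] um(1) \<open>um < c\<close> u0_bounds[OF c] by auto
qed

lemma traveling_wave_wave:
  assumes "\<epsilon> > 0" and "\<delta> > 0" and c: "c > 1"
    and "\<epsilon>\<^sup>2 \<ge> 4 * \<delta> * c * alpha c"
    and tw: "traveling_wave \<epsilon> \<delta> c u"
  shows "wave (\<delta> * c) \<epsilon> c u (deriv u) (deriv (deriv u))"
proof -
  note tw = tw[unfolded traveling_wave_def]
  have D: "((deriv ^^ n) u has_real_derivative (deriv ^^ Suc n) u x) (at x)" for n x
    using tw by (simp add: smooth_def DERIV_deriv_iff_field_differentiable)
  have Du: "(u has_real_derivative deriv u x) (at x)" for x
    using D[of 0 x] by simp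
  have Dv: "(deriv u has_real_derivative deriv (deriv u) x) (at x)" for x
    using D[of 1 x] by simp
  obtain \<eta> um where um: "um > 0" and lim: "((\<lambda>\<xi>. (eta c u \<xi>, u \<xi>)) \<longlongrightarrow> (\<eta>, um)) at_bot"
    using tw by blast
  have eta_bot: "(eta c u \<longlongrightarrow> \<eta>) at_bot" and u_bot: "(u \<longlongrightarrow> um) at_bot"
    using tendsto_fst[OF lim] tendsto_snd[OF lim] by simp_all
  have top: "((\<lambda>\<xi>. (eta c u \<xi>, u \<xi>)) \<longlongrightarrow> (0, 0)) at_top" using tw by blast
  have u_top: "(u \<longlongrightarrow> 0) at_top" using tendsto_snd[OF top] by simp
  have derivs: "((deriv ^^ j) u \<longlongrightarrow> 0) at_bot" "((deriv ^^ j) u \<longlongrightarrow> 0) at_top" if "j \<ge> 1" for j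
  proof -
    have "((\<lambda>\<xi>. ((deriv ^^ j) (eta c u) \<xi>, (deriv ^^ j) u \<xi>)) \<longlongrightarrow> (0, 0)) at_bot"
      "((\<lambda>\<xi>. ((deriv ^^ j) (eta c u) \<xi>, (deriv ^^ j) u \<xi>)) \<longlongrightarrow> (0, 0)) at_top"
      using tw that by blast+
    from this[THEN tendsto_snd] show "((deriv ^^ j) u \<longlongrightarrow> 0) at_bot" "((deriv ^^ j) u \<longlongrightarrow> 0) at_top"
      by simp_all
  qed
  have v: "(deriv u \<longlongrightarrow> 0) at_bot" "(deriv u \<longlongrightarrow> 0) at_top"
    using derivs[of 1] by simp_all
  have w: "(deriv (deriv u) \<longlongrightarrow> 0) at_bot" "(deriv (deriv u) \<longlongrightarrow> 0) at_top"
    using derivs[of 2] by (simp_all add: numeral_2_eq_2)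
  have ode: "\<delta> * c * deriv (deriv u) x = \<epsilon> * deriv u x + F c (u x)" for x
  proof -
    have "- c * u x - u x / (u x - c) + 1 / 2 * (u x)\<^sup>2
            + \<delta> * c * deriv (deriv u) x - \<epsilon> * deriv u x = 0"
      using tw by blast
    then show ?thesis by (simp add: F_def)
  qed
  have less_c: "u x < c" for x
  proof (rule less_of_tendsto_less[OF _ _ u_top])
    show "continuous_on UNIV u"
      by (rule DERIV_continuous_on) (rule has_field_derivative_at_within[OF Du])
  qed (use tw c in auto)
  \<comment> \<open>By the equation this expression is \<open>F c (u x)\<close>, so the left limit
    is an equilibrium.\<close>
  have "((\<lambda>x. \<delta> * c * deriv (deriv u) x - \<epsilon> * deriv u x) \<longlongrightarrow> \<delta> * c * 0 - \<epsilon> * 0) at_bot"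
    by (intro tendsto_intros v w)
  then have "((\<lambda>x. F c (u x)) \<longlongrightarrow> 0) at_bot"
    by (simp add: ode)
  then have "um = u0 c"
    by (intro traveling_wave_limit[OF c less_c eta_bot _ um u_bot]) auto
  then show ?thesis
    using assms less_c Du Dv ode u_bot u_top v w by unfold_locales (auto simp: mult.assoc)
qed

section \<open>Inflection points and conclusion\<close>

lemma inflection_point_iff:
  assumes "\<And>x. x < r \<Longrightarrow> deriv (deriv f) x < 0" "\<And>x. r < x \<Longrightarrow> deriv (deriv f) x > 0"
  shows "inflection_point f x \<longleftrightarrow> x = r"
proof
  assume "x = r"
  then show "inflection_point f x"
    unfolding inflection_point_def using assms by (intro exI[of _ 1]) auto
next
  assume "inflection_point f x"
  then obtain d where d: "d > 0"
    and alt: "(\<forall>y\<in>{x-d<..<x}. deriv (deriv f) y < 0) \<and> (\<forall>y\<in>{x<..<x+d}. deriv (deriv f) y > 0) \<or>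
              (\<forall>y\<in>{x-d<..<x}. deriv (deriv f) y > 0) \<and> (\<forall>y\<in>{x<..<x+d}. deriv (deriv f) y < 0)"
    unfolding inflection_point_def by blast
  show "x = r"
  proof (rule ccontr)
    assume "x \<noteq> r"
    \<comment> \<open>Small enough that \<open>x - h\<close> and \<open>x + h\<close> lie in the
      window of radius \<open>d\<close> and on the same side of \<open>r\<close>, where u'' keeps
      its sign.\<close>
    define h where "h = min (d / 2) (\<bar>x - r\<bar> / 2)"
    have h: "0 < h" "h < d" "h < \<bar>x - r\<bar>" using d \<open>x \<noteq> r\<close> by (auto simp: h_def min_def)
    then have "x - h \<in> {x-d<..<x}" "x + h \<in> {x<..<x+d}" by auto
    with alt have "deriv (deriv f) (x - h) < 0 \<and> deriv (deriv f) (x + h) > 0 \<or>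
        deriv (deriv f) (x - h) > 0 \<and> deriv (deriv f) (x + h) < 0" by blast
    moreover have "x - h < r \<and> x + h < r \<or> x - h > r \<and> x + h > r" using h by linarith
    ultimately show False using assms[of "x - h"] assms[of "x + h"] by auto
  qed
qed

theorem theorem3p1:
  fixes \<epsilon> \<delta> c :: real and u :: "real \<Rightarrow> real"
  assumes "\<epsilon> > 0" and "\<delta> > 0" and "c > 1"
    and "\<epsilon>\<^sup>2 \<ge> 4 * \<delta> * c * alpha c"
    and "traveling_wave \<epsilon> \<delta> c u"
  shows "(\<forall>\<xi>. 0 < u \<xi> \<and> u \<xi> < u0 c \<and> deriv u \<xi> < 0) \<and>
         (\<exists>\<xi>1. inflection_point u \<xi>1 \<and> (\<forall>\<xi>. inflection_point u \<xi> \<longrightarrow> \<xi> = \<xi>1) \<and>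
               (\<forall>\<xi>. \<xi> \<noteq> \<xi>1 \<longrightarrow> (\<xi> - \<xi>1) * deriv (deriv u) \<xi> > 0))"
proof -
  interpret wave "\<delta> * c" \<epsilon> c u "deriv u" "deriv (deriv u)"
    by (rule traveling_wave_wave[OF assms])
  obtain r where r: "\<And>x. x < r \<Longrightarrow> deriv (deriv u) x < 0" "\<And>x. r < x \<Longrightarrow> deriv (deriv u) x > 0"
    by (rule inflection) blast
  have "(\<xi> - r) * deriv (deriv u) \<xi> > 0" if "\<xi> \<noteq> r" for \<xi>
    using that r[of \<xi>] by (cases \<xi> r rule: linorder_cases) (auto intro: mult_neg_neg mult_pos_pos)
  moreover have "inflection_point u \<xi> \<longleftrightarrow> \<xi> = r" for \<xi>
    by (rule inflection_point_iff[OF r])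
  ultimately show ?thesis
    by (intro conjI exI[of _ r]) (simp_all add: pos less_u0 decreasing)
qed

end
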